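(* Let $G$ be a finite group and let $H$ be a subgroup of $G$ with $H \neq L(H,\mathrm{Aut}(G))$. Then \[ \Pr(H,\mathrm{Aut}(G)) \geq \frac{1}{|[H,\mathrm{Aut}(G)]|}\left(1 + \frac{|[H,\mathrm{Aut}(G)]| - 1}{|H : L(H,\mathrm{Aut}(G))|}\right). \]
   Context: For a subgroup $H$ of a finite group $G$ with automorphism group $\mathrm{Aut}(G)$: $\Pr(H,\mathrm{Aut}(G)) := \dfrac{|\{(x,\alpha)\in H\times \mathrm{Aut}(G) : \alpha(x)=x\}|}{|H||\mathrm{Aut}(G)|}$; $L(H,\mathrm{Aut}(G)) := \{x\in H : \alpha(x)=x \text{ for all } \alpha\in \mathrm{Aut}(G)\}$, which is a normal subgroup of $H$; $[x,\alpha] := x^{-1}\alpha(x)$ for $x\in G$, $\alpha\in\mathrm{Aut}(G)$; and $[H,\mathrm{Aut}(G)]$ is the subgroup of $G$ generated by $\{[x,\alpha] : x\in H,\ \alpha\in\mathrm{Aut}(G)\}$. *)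

theory Defs
  imports Complex_Main "HOL-Algebra.Bij" "HOL-Algebra.Generated_Groups"
begin

text \<open>
  The automorphism group is represented by its carrier \<open>auto G\<close>. Its elements are extensional
  functions on \<open>carrier G\<close>, so distinct members are distinct automorphisms and
  \<open>card (auto G)\<close> is the order of the automorphism group.
\<close>

definition Pr_Aut :: "('a, 'b) monoid_scheme \<Rightarrow> 'a set \<Rightarrow> real" where
  "Pr_Aut G H =
     real (card {(x, \<alpha>) \<in> H \<times> auto G. \<alpha> x = x}) / (real (card H) * real (card (auto G)))"

definition L_Aut :: "('a, 'b) monoid_scheme \<Rightarrow> 'a set \<Rightarrow> 'a set" where
  "L_Aut G H = {x \<in> H. \<forall>\<alpha> \<in> auto G. \<alpha> x = x}"

definition autocommutator :: "('a, 'b) monoid_scheme \<Rightarrow> 'a \<Rightarrow> ('a \<Rightarrow> 'a) \<Rightarrow> 'a" where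
  "autocommutator G x \<alpha> = inv\<^bsub>G\<^esub> x \<otimes>\<^bsub>G\<^esub> \<alpha> x"

definition Comm_Aut :: "('a, 'b) monoid_scheme \<Rightarrow> 'a set \<Rightarrow> 'a set" where
  "Comm_Aut G H = generate G {autocommutator G x \<alpha> | x \<alpha>. x \<in> H \<and> \<alpha> \<in> auto G}"

definition subgroup_index :: "('a, 'b) monoid_scheme \<Rightarrow> 'a set \<Rightarrow> 'a set \<Rightarrow> nat" where
  "subgroup_index G H K = card (rcosets\<^bsub>G\<lparr>carrier := H\<rparr>\<^esub> K)"

end

theory Submission
  imports Defs "HOL-Algebra.Group_Action"
begin

text \<open>
  Counting the fixed pairs one point at a time, \<open>Pr_Aut G H\<close> is the average over \<open>x \<in> H\<close> of the
  proportion of automorphisms that fix \<open>x\<close>, and by the orbit-stabilizer theorem this proportion is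
  the reciprocal of the size of the orbit of \<open>x\<close>. Every orbit is small: since
  \<open>\<alpha> x = x [x, \<alpha>]\<close>, the orbit of \<open>x\<close> lies in the coset \<open>x [H, Aut(G)]\<close>, so the proportion is at
  least \<open>1 / |[H, Aut(G)]|\<close> (\<open>auto_group_le_commutator_times_fixing\<close>). For \<open>x\<close> in
  \<open>L = L(H, Aut(G))\<close> it is \<open>1\<close>. As \<open>L\<close> makes up the fraction \<open>1 / |H : L|\<close> of \<open>H\<close>
  (\<open>subgroup_index_L_Aut_times_card\<close>), averaging gives
  \<open>1 / |H : L| + (1 - 1 / |H : L|) / |[H, Aut(G)]|\<close>, which is the stated bound rearranged.
\<close>

lemma (in group) group_action_AutoGroup: "group_action (AutoGroup G) (carrier G) (\<lambda>\<alpha>. \<alpha>)"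
proof -
  have "(\<lambda>\<alpha>. \<alpha>) \<in> hom (AutoGroup G) (BijGroup (carrier G))"
    using subgroup.subset[OF subgroup_auto] by (auto simp: hom_def AutoGroup_def)
  then show ?thesis
    by (intro group_action.intro group_hom.intro group_hom_axioms.intro AutoGroup group_BijGroup)
qed

lemma (in group) auto_closed:
  assumes "\<alpha> \<in> auto G" and "x \<in> carrier G"
  shows "\<alpha> x \<in> carrier G"
  using assms by (auto simp: auto_def hom_def)

lemma (in group) subgroup_Comm_Aut:
  assumes "H \<subseteq> carrier G"
  shows "subgroup (Comm_Aut G H) G"
  unfolding Comm_Aut_def using assms
  by (intro generate_is_subgroup) (auto simp: autocommutator_def auto_closed subset_iff)

lemma (in group) auto_image_mem_Comm_Aut_coset:
  assumes "H \<subseteq> carrier G" and "x \<in> H" and "\<alpha> \<in> auto G"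
  shows "\<alpha> x \<in> x <# Comm_Aut G H"
proof -
  have "autocommutator G x \<alpha> \<in> Comm_Aut G H"
    unfolding Comm_Aut_def by (rule generate.incl) (use assms in blast)
  moreover have "\<alpha> x = x \<otimes> autocommutator G x \<alpha>"
    using assms auto_closed[of \<alpha> x] by (auto simp: autocommutator_def m_assoc[symmetric] subset_iff)
  ultimately show ?thesis
    by (auto simp: l_coset_def)
qed

text \<open>
  The orbit-stabilizer theorem, with the orbit of \<open>x\<close> estimated by the size of a coset of
  \<open>[H, Aut(G)]\<close> that contains it.
\<close>

lemma (in group) auto_group_le_commutator_times_fixing:
  assumes "finite (carrier G)" and "H \<subseteq> carrier G" and "x \<in> H"
  shows "card (auto G) \<le> card (Comm_Aut G H) * card {\<alpha> \<in> auto G. \<alpha> x = x}"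
proof -
  let ?K = "Comm_Aut G H"
  interpret A: group_action "AutoGroup G" "carrier G" "\<lambda>\<alpha>. \<alpha>"
    by (rule group_action_AutoGroup)
  have finK: "finite ?K"
    using subgroup.subset[OF subgroup_Comm_Aut[OF assms(2)]] assms(1) finite_subset by blast
  have "orbit (AutoGroup G) (\<lambda>\<alpha>. \<alpha>) x \<subseteq> (\<lambda>k. x \<otimes> k) ` ?K"
    using auto_image_mem_Comm_Aut_coset[OF assms(2,3)]
    by (auto simp: orbit_def AutoGroup_def l_coset_def)
  then have "card (orbit (AutoGroup G) (\<lambda>\<alpha>. \<alpha>) x) \<le> card ?K"
    using finK by (meson card_image_le card_mono finite_imageI order_trans)
  then have "card (orbit (AutoGroup G) (\<lambda>\<alpha>. \<alpha>) x) * card {\<alpha> \<in> auto G. \<alpha> x = x}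
      \<le> card ?K * card {\<alpha> \<in> auto G. \<alpha> x = x}"
    by (rule mult_le_mono1)
  moreover have "card (orbit (AutoGroup G) (\<lambda>\<alpha>. \<alpha>) x) * card {\<alpha> \<in> auto G. \<alpha> x = x} = card (auto G)"
    using A.orbit_stabilizer_theorem[of x] assms
    by (auto simp: stabilizer_def order_def AutoGroup_def)
  ultimately show ?thesis
    by simp
qed

lemma (in group) subgroup_L_Aut:
  assumes "subgroup H G"
  shows "subgroup (L_Aut G H) G"
proof (rule subgroupI)
  have hom: "\<alpha> \<in> hom G G" if "\<alpha> \<in> auto G" for \<alpha>
    using that by (simp add: auto_def)
  have HG: "H \<subseteq> carrier G"
    using assms by (rule subgroup.subset)
  then show "L_Aut G H \<subseteq> carrier G"
    by (auto simp: L_Aut_def)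
  have "\<one> \<in> L_Aut G H"
    using subgroup.one_closed[OF assms] hom_one[OF hom is_group is_group] by (simp add: L_Aut_def)
  then show "L_Aut G H \<noteq> {}"
    by blast
  fix a assume a: "a \<in> L_Aut G H"
  have "\<alpha> (inv a) = inv a" if "\<alpha> \<in> auto G" for \<alpha>
  proof -
    interpret group_hom G G \<alpha>
      using hom[OF that] by (intro group_hom.intro group_hom_axioms.intro is_group)
    show ?thesis
      using a that HG by (auto simp: L_Aut_def subset_iff)
  qed
  then show "inv a \<in> L_Aut G H"
    using a subgroup.m_inv_closed[OF assms] by (auto simp: L_Aut_def)
  fix b assume b: "b \<in> L_Aut G H"
  have "a \<in> carrier G" and "b \<in> carrier G"
    using a b HG by (auto simp: L_Aut_def)
  have "\<alpha> (a \<otimes> b) = a \<otimes> b" if "\<alpha> \<in> auto G" for \<alpha>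
  proof -
    have "\<alpha> a = a" and "\<alpha> b = b"
      using a b that by (auto simp: L_Aut_def)
    then show ?thesis
      using hom_mult[OF hom[OF that] \<open>a \<in> carrier G\<close> \<open>b \<in> carrier G\<close>] by simp
  qed
  then show "a \<otimes> b \<in> L_Aut G H"
    using a b subgroup.m_closed[OF assms] by (simp add: L_Aut_def)
qed

lemma (in group) subgroup_index_L_Aut_times_card:
  assumes "subgroup H G"
  shows "subgroup_index G H (L_Aut G H) * card (L_Aut G H) = card H"
proof -
  interpret H: group "G\<lparr>carrier := H\<rparr>"
    using assms by (rule subgroup_imp_group)
  have "subgroup (L_Aut G H) (G\<lparr>carrier := H\<rparr>)"
    by (rule subgroup_incl[OF subgroup_L_Aut[OF assms] assms]) (auto simp: L_Aut_def)
  from H.lagrange[OF this] show ?thesis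
    by (simp add: subgroup_index_def order_def)
qed

theorem corollary3p3:
  fixes G :: "('a, 'b) monoid_scheme" and H :: "'a set"
  assumes "group G"
    and "finite (carrier G)"
    and "subgroup H G"
    and "H \<noteq> L_Aut G H"
  shows "Pr_Aut G H \<ge>
    1 / real (card (Comm_Aut G H)) *
      (1 + (real (card (Comm_Aut G H)) - 1) / real (subgroup_index G H (L_Aut G H)))"
proof -
  interpret group G by fact
  define L where "L = L_Aut G H"
  define S where "S x = {\<alpha> \<in> auto G. \<alpha> x = x}" for x
  define k where "k = real (card (Comm_Aut G H))"
  define a where "a = real (card (auto G))"
  define l where "l = real (card L)"
  define h where "h = real (card H)"
  define n where "n = real (subgroup_index G H L)"
  have HG: "H \<subseteq> carrier G"
    using assms(3) by (rule subgroup.subset)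
  have finH: "finite H"
    using HG assms(2) by (rule finite_subset)
  have LH: "L \<subseteq> H"
    by (auto simp: L_def L_Aut_def)
  have finA: "finite (auto G)"
  proof (rule finite_subset)
    show "auto G \<subseteq> carrier G \<rightarrow>\<^sub>E carrier G"
      by (auto simp: auto_def hom_def Bij_def PiE_def)
  qed (simp add: finite_PiE assms(2))
  have k: "k > 0"
    using subgroup.finite_imp_card_positive[OF subgroup_Comm_Aut[OF HG] assms(2)]
    by (simp add: k_def)
  have a: "a > 0"
    using finA id_in_auto by (auto simp: a_def card_gt_0_iff)
  have h: "h > 0"
    using subgroup.finite_imp_card_positive[OF assms(3,2)] by (simp add: h_def)
  have nl: "n * l = h"
    unfolding n_def l_def h_def L_def of_nat_mult[symmetric]
    using subgroup_index_L_Aut_times_card[OF assms(3)] by simp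
  have n: "n > 0" and l: "l > 0"
    using nl h by (auto simp: n_def l_def zero_less_mult_iff)

  have "{(x, \<alpha>) \<in> H \<times> auto G. \<alpha> x = x} = Sigma H S"
    by (auto simp: S_def)
  moreover have "\<forall>x\<in>H. finite (S x)"
    using finA by (auto simp: S_def)
  ultimately have "real (card {(x, \<alpha>) \<in> H \<times> auto G. \<alpha> x = x}) = (\<Sum>x\<in>H. real (card (S x)))"
    using finH by simp
  also have "\<dots> = (\<Sum>x\<in>H - L. real (card (S x))) + (\<Sum>x\<in>L. real (card (S x)))"
    using sum.subset_diff[OF LH finH] .
  also have "\<dots> \<ge> (\<Sum>x\<in>H - L. a / k) + (\<Sum>x\<in>L. a)"
  proof (intro add_mono sum_mono)
    fix x assume "x \<in> H - L"
    then have "card (auto G) \<le> card (Comm_Aut G H) * card (S x)"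
      using auto_group_le_commutator_times_fixing[OF assms(2) HG, of x] by (simp add: S_def)
    then have "a \<le> k * real (card (S x))"
      unfolding a_def k_def of_nat_mult[symmetric] by (rule of_nat_mono)
    then show "a / k \<le> real (card (S x))"
      using k by (simp add: field_simps)
  next
    fix x assume "x \<in> L"
    then have "S x = auto G"
      by (auto simp: S_def L_def L_Aut_def)
    then show "a \<le> real (card (S x))"
      by (simp add: a_def)
  qed
  also have "(\<Sum>x\<in>H - L. a / k) + (\<Sum>x\<in>L. a) = (h - l) * (a / k) + l * a"
    using card_Diff_subset[OF finite_subset[OF LH finH] LH] card_mono[OF finH LH]
    by (simp add: h_def l_def)
  finally have "((h - l) * (a / k) + l * a) / (h * a) \<le> Pr_Aut G H"
    using h a by (simp add: Pr_Aut_def h_def a_def divide_right_mono)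
  moreover have "((h - l) * (a / k) + l * a) / (h * a) = 1 / k * (1 + (k - 1) / n)"
    unfolding nl[symmetric] using k a n l by (simp add: field_simps)
  ultimately show ?thesis
    by (simp add: k_def n_def L_def)
qed

end
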